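(* Let $a,b,c,d,q\in\mathbb{C}$ with $|q|<1$ and let $s\in\mathbb{C}$ be generic; write $s=q^{-\lambda}$. Let $f(x;s)=x^{-\lambda}\sum_{n\ge0}c_nx^n$ with $c_0=1$ be the unique formal series satisfying $$Df(x;s)=\Big(s+\frac{abcd}{qs}-1-\frac{abcd}{q}\Big)f(x;s),$$ where $D$ is the Askey–Wilson operator described in the context. Then $$f(x;s)=x^{-\lambda}\frac{(ax;q)_\infty}{(qx/a;q)_\infty}\sum_{n\ge0}\frac{(qs^2/a^2;q)_n}{(q;q)_n}\Big(\frac{ax}{s}\Big)^n\,{}_6\phi_5\!\left[{q^{-n},\,q^{n+1}s^2/a^2,\,s,\,qs/ab,\,qs/ac,\,qs/ad\atop q^2s^2/abcd,\,q^{1/2}s/a,\,-q^{1/2}s/a,\,qs/a,\,-qs/a};q,q\right],$$ where $(ax;q)_\infty/(qx/a;q)_\infty$ is expanded as a formal power series in $x$.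
   Context: Notation: $(a_1,\dots,a_k;q)_n=\prod_{j=1}^k\prod_{i=0}^{n-1}(1-q^ia_j)$ (also for $n=\infty$), and ${}_{r+1}\phi_r\left[{a_1,\dots,a_{r+1}\atop b_1,\dots,b_r};q,z\right]=\sum_{m\ge0}\frac{(a_1,\dots,a_{r+1};q)_m}{(q,b_1,\dots,b_r;q)_m}z^m$. The Askey–Wilson $q$-difference operator is $$D=\frac{(1-ax)(1-bx)(1-cx)(1-dx)}{(1-x^2)(1-qx^2)}(T_{q,x}-1)+\frac{(1-a/x)(1-b/x)(1-c/x)(1-d/x)}{(1-1/x^2)(1-q/x^2)}(T_{q,x}^{-1}-1),$$ where $T_{q,x}^{\pm1}g(x)=g(q^{\pm1}x)$; on formal series one uses $T_{q,x}x^{-\lambda+n}=sq^nx^{-\lambda+n}$. The eigenvalue equation together with $c_0=1$ determines the coefficients $c_n$ uniquely as rational functions of $a,b,c,d,q,s$. *)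

theory Defs
  imports "HOL-Complex_Analysis.Complex_Analysis"
begin

definition qpoch :: "complex list \<Rightarrow> complex \<Rightarrow> nat \<Rightarrow> complex" where
  "qpoch us q n = (\<Prod>u\<leftarrow>us. \<Prod>i<n. 1 - q ^ i * u)"

definition qpoch_inf :: "complex \<Rightarrow> complex \<Rightarrow> complex" where
  "qpoch_inf u q = (\<Prod>i. 1 - q ^ i * u)"

text \<open>Basic hypergeometric series; intended for \<open>length us = length vs + 1\<close>.\<close>

definition qhyp :: "complex list \<Rightarrow> complex list \<Rightarrow> complex \<Rightarrow> complex \<Rightarrow> complex" where
  "qhyp us vs q z = (\<Sum>m. qpoch us q m / qpoch (q # vs) q m * z ^ m)"

text \<open>
  A formal series \<open>x\<^sup>-\<^sup>\<lambda> F(x)\<close> is represented by its Laurent series factor \<open>F\<close>; the factor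
  \<open>x\<^sup>-\<^sup>\<lambda>\<close> only enters through \<open>s = q\<^sup>-\<^sup>\<lambda>\<close>, since \<open>T\<^bsub>q,x\<^esub> x\<^bsup>-\<lambda>+n\<^esup> = s q\<^sup>n x\<^bsup>-\<lambda>+n\<^esup>\<close>.
  The inverse shift is \<open>T\<^bsub>1/q,x\<^esub>\<close>, which maps \<open>x\<^bsup>-\<lambda>+n\<^esup>\<close> to \<open>s\<^sup>-\<^sup>1 q\<^sup>-\<^sup>n x\<^bsup>-\<lambda>+n\<^esup>\<close>, that is,
  \<open>qshift (1 / q) (1 / s)\<close>.
\<close>

lift_definition qshift :: "complex \<Rightarrow> complex \<Rightarrow> complex fls \<Rightarrow> complex fls" is
  "\<lambda>q s F n. s * q powi n * F n"
  by (erule MOST_mono) simp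

lemma qshift_inverse:
  assumes "q \<noteq> 0" "s \<noteq> 0"
  shows "qshift (1 / q) (1 / s) (qshift q s F) = F"
  using assms by (intro fls_eqI) (simp add: qshift.rep_eq power_int_divide_distrib)

text \<open>
  The rational coefficients of the operator are read in the field of formal Laurent series,
  i.e. they are expanded at \<open>x = 0\<close>.
\<close>

definition askey_wilson ::
  "complex \<Rightarrow> complex \<Rightarrow> complex \<Rightarrow> complex \<Rightarrow> complex \<Rightarrow> complex \<Rightarrow> complex fls \<Rightarrow> complex fls"
where
  "askey_wilson a b c d q s F =
    (let x = fls_X; k = fls_const in
      (1 - k a * x) * (1 - k b * x) * (1 - k c * x) * (1 - k d * x)
        / ((1 - x ^ 2) * (1 - k q * x ^ 2)) * (qshift q s F - F)
    + (1 - k a / x) * (1 - k b / x) * (1 - k c / x) * (1 - k d / x)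
        / ((1 - 1 / x ^ 2) * (1 - k q / x ^ 2)) * (qshift (1 / q) (1 / s) F - F))"

text \<open>\<open>C\<close> is the power series \<open>\<Sum>\<^sub>n c\<^sub>n x\<^sup>n\<close> in \<open>f(x;s) = x\<^sup>-\<^sup>\<lambda> \<Sum>\<^sub>n c\<^sub>n x\<^sup>n\<close>.\<close>

definition is_aw_series ::
  "complex \<Rightarrow> complex \<Rightarrow> complex \<Rightarrow> complex \<Rightarrow> complex \<Rightarrow> complex \<Rightarrow> complex fps \<Rightarrow> bool"
where
  "is_aw_series a b c d q s C \<longleftrightarrow>
     fps_nth C 0 = 1 \<and>
     askey_wilson a b c d q s (fps_to_fls C) =
       fls_const (s + a * b * c * d / (q * s) - 1 - a * b * c * d / q) * fps_to_fls C"

end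

theory Submission
  imports Defs
begin

text \<open>
  Interchanging the two summations and summing the inner series by the \<open>q\<close>-binomial theorem turns
  the claimed series into \<open>\<Sum>\<^sub>m h\<^sub>m \<phi>\<^sub>m\<close> with
  \<open>\<phi>\<^sub>m = x\<^sup>m (ax, q\<^bsup>m+1\<^esup>sx/a; q)\<^sub>\<infinity> / (qx/a, q\<^bsup>-m\<^esup>ax/s; q)\<^sub>\<infinity>\<close>. Up to a quasi-periodic factor,
  \<open>x\<^bsup>-\<lambda>\<^esup> \<phi>\<^sub>m\<close> is the shifted factorial \<open>(ax, a/x; q)\<^bsub>\<lambda>-m\<^esub>\<close>, on which the operator acts by two terms,
  as it does for the Askey-Wilson polynomials:
  \<open>D \<phi>\<^sub>m = E(sq\<^sup>m) \<phi>\<^sub>m + \<gamma>\<^sub>m \<phi>\<^bsub>m+1\<^esub>\<close>, where \<open>E(s)\<close> is the eigenvalue. The eigenvalue equation is then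
  the recursion \<open>h\<^bsub>m+1\<^esub> (E(sq\<^bsup>m+1\<^esup>) - E(s)) = - h\<^sub>m \<gamma>\<^sub>m\<close>. Uniqueness holds because \<open>D - E(s)\<close> multiplies
  the lowest coefficient \<open>c\<^sub>n\<close> of a series by \<open>E(sq\<^sup>n) - E(s)\<close>, which is nonzero for \<open>n \<ge> 1\<close>.
\<close>

subsection \<open>The infinite \<open>q\<close>-shifted factorial\<close>

lemma LIMSEQ_qpoch_inf:
  assumes "norm q < 1"
  shows "(\<lambda>n. \<Prod>i<n. 1 - q ^ i * u) \<longlonglongrightarrow> qpoch_inf u q"
proof -
  have "summable (\<lambda>i. norm (1 - q ^ i * u - 1))"
    using summable_mult2[OF summable_geometric[of "norm q"], of "norm u"] assms
    by (simp add: norm_mult norm_power)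
  then have "convergent_prod (\<lambda>i. 1 - q ^ i * u)"
    by (intro abs_convergent_prod_imp_convergent_prod summable_imp_abs_convergent_prod)
  then show ?thesis
    unfolding qpoch_inf_def LIMSEQ_lessThan_iff_atMost by (rule convergent_prod_LIMSEQ)
qed

lemma qpoch_inf_rec:
  assumes "norm q < 1"
  shows "qpoch_inf u q = (1 - u) * qpoch_inf (q * u) q"
proof (rule LIMSEQ_unique)
  show "(\<lambda>n. \<Prod>i<Suc n. 1 - q ^ i * u) \<longlonglongrightarrow> qpoch_inf u q"
    using LIMSEQ_qpoch_inf[OF assms] by (rule LIMSEQ_Suc)
  show "(\<lambda>n. \<Prod>i<Suc n. 1 - q ^ i * u) \<longlonglongrightarrow> (1 - u) * qpoch_inf (q * u) q"
    unfolding prod.lessThan_Suc_shift power_0 mult_1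
    using tendsto_mult_left[OF LIMSEQ_qpoch_inf[OF assms], of "1 - u" "q * u"]
    by (simp add: mult_ac)
qed

lemma qpoch_inf_0 [simp]: "qpoch_inf 0 q = 1"
  by (simp add: qpoch_inf_def)

text \<open>On a closed ball the deviations of the factors from 1 are dominated by a geometric
  series, so the partial products converge locally uniformly.\<close>

lemma holomorphic_qpoch_inf:
  assumes "norm q < 1"
  shows "(\<lambda>u. qpoch_inf u q) holomorphic_on UNIV"
proof (rule holomorphic_uniform_sequence)
  fix z :: complex
  let ?P = "\<lambda>n u. \<Prod>i<n. 1 - q ^ i * u"
  have "uniformly_convergent_on (cball z 1) ?P"
  proof (rule uniformly_convergent_on_prod')
    show "uniformly_convergent_on (cball z 1) (\<lambda>N u. \<Sum>n<N. norm (1 - q ^ n * u - 1))"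
    proof (rule Weierstrass_m_test')
      fix n u assume "u \<in> cball z 1"
      then have "norm u \<le> norm z + 1"
        using norm_triangle_sub[of u z] by (simp add: dist_norm norm_minus_commute)
      then show "norm (norm (1 - q ^ n * u - 1)) \<le> norm q ^ n * (norm z + 1)"
        by (simp add: norm_mult norm_power mult_left_mono)
    qed (use assms in \<open>auto intro!: summable_mult2 summable_geometric\<close>)
  qed (auto intro!: continuous_intros)
  then obtain g where g: "uniform_limit (cball z 1) ?P g sequentially"
    by (auto simp: uniformly_convergent_on_def)
  have "g u = qpoch_inf u q" if "u \<in> cball z 1" for u
    using tendsto_uniform_limitI[OF g that] LIMSEQ_qpoch_inf[OF assms] LIMSEQ_unique by blast
  then have "uniform_limit (cball z 1) ?P (\<lambda>u. qpoch_inf u q) sequentially"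
    using g by (subst (asm) uniform_limit_cong') auto
  then show "\<exists>d>0. cball z d \<subseteq> UNIV \<and> uniform_limit (cball z d) ?P (\<lambda>u. qpoch_inf u q) sequentially"
    by (intro exI[of _ 1]) auto
qed (auto intro!: holomorphic_intros)

subsection \<open>Dilations and the \<open>q\<close>-binomial series\<close>

text \<open>The substitution of \<open>q x\<close> for \<open>x\<close>: on
  \<open>x^(-\<lambda>) F\<close> the shift acts as \<open>s\<close> times it. Being a composition,
  it is multiplicative.\<close>

definition qdil :: "complex \<Rightarrow> complex fps \<Rightarrow> complex fps" where
  "qdil q F = F oo (fps_const q * fps_X)"

lemma qdil_nth [simp]: "fps_nth (qdil q F) n = q ^ n * fps_nth F n"
  by (simp add: qdil_def)

lemma qdil_mult [simp]: "qdil q (F * G) = qdil q F * qdil q G"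
  unfolding qdil_def by (rule fps_compose_mult_distrib) simp

lemma qdil_diff [simp]: "qdil q (F - G) = qdil q F - qdil q G"
  by (simp add: fps_eq_iff algebra_simps)

lemma qdil_add [simp]: "qdil q (F + G) = qdil q F + qdil q G"
  by (simp add: fps_eq_iff algebra_simps)

lemma qdil_const [simp]: "qdil q (fps_const h) = fps_const h"
  by (simp add: fps_eq_iff)

lemma qdil_X_power [simp]: "qdil q (fps_X ^ n) = fps_const (q ^ n) * fps_X ^ n"
  by (simp add: fps_eq_iff fps_X_power_nth)

lemma qdil_linear: "qdil q (1 - fps_const c * fps_X) = 1 - fps_const (q * c) * fps_X"
  by (rule fps_ext) (auto simp: le_Suc_eq simp del: qdil_diff)

lemma qdil_qdil: "qdil p (qdil q F) = qdil (p * q) F"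
  by (simp add: fps_eq_iff power_mult_distrib mult_ac)

lemma qdil_1 [simp]: "qdil 1 F = F"
  by (simp add: fps_eq_iff)

text \<open>The expansion of \<open>(ux; q)\<^sub>\<infinity> / (wx; q)\<^sub>\<infinity>\<close>; this form of the coefficients also covers \<open>w = 0\<close>.\<close>

definition qbin :: "complex \<Rightarrow> complex \<Rightarrow> complex \<Rightarrow> complex fps" where
  "qbin q u w = Abs_fps (\<lambda>n. \<Prod>i<n. (w - u * q ^ i) / (1 - q ^ Suc i))"

lemma qbin_nth_0 [simp]: "fps_nth (qbin q u w) 0 = 1"
  by (simp add: qbin_def)

lemma power_neq_1:
  fixes q :: complex
  assumes "norm q < 1" "n > 0"
  shows "q ^ n \<noteq> 1"
proof
  assume "q ^ n = 1"
  then have "norm q ^ n = 1" by (metis norm_one norm_power)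
  moreover have "norm q ^ n < 1" using assms by (simp add: power_less_one_iff)
  ultimately show False by simp
qed

text \<open>Comparing coefficients of \<open>x^(n+1)\<close> gives a first-order recursion whose
  leading factor \<open>1 - q^(n+1)\<close> never vanishes.\<close>

lemma qbin_unique:
  assumes q: "norm q < 1" and K0: "fps_nth K 0 = 1"
    and eq: "(1 - fps_const u * fps_X) * qdil q K = (1 - fps_const w * fps_X) * K"
  shows "K = qbin q u w"
proof -
  have "fps_nth K n = (\<Prod>i<n. (w - u * q ^ i) / (1 - q ^ Suc i))" for n
  proof (induction n)
    case (Suc n)
    have "fps_nth ((1 - fps_const u * fps_X) * qdil q K) (Suc n) =
          fps_nth ((1 - fps_const w * fps_X) * K) (Suc n)"
      by (simp only: eq)
    then have "fps_nth K (Suc n) * (1 - q ^ Suc n) = fps_nth K n * (w - u * q ^ n)"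
      by (simp add: left_diff_distrib mult.assoc algebra_simps)
    then have "fps_nth K (Suc n) = fps_nth K n * ((w - u * q ^ n) / (1 - q ^ Suc n))"
      using power_neq_1[OF q, of "Suc n"] by (simp add: field_simps del: power_Suc)
    then show ?case using Suc by simp
  qed (simp add: K0)
  then show ?thesis by (simp add: qbin_def fps_eq_iff)
qed

text \<open>In product form: replacing \<open>x\<close> by \<open>q x\<close> strips the first
  factor of each infinite product.\<close>

lemma qbin_eq:
  assumes q: "norm q < 1"
  shows "(1 - fps_const u * fps_X) * qdil q (qbin q u w) = (1 - fps_const w * fps_X) * qbin q u w"
    (is "?l = ?r")
proof (rule fps_ext)
  fix n show "fps_nth ?l n = fps_nth ?r n"
  proof (cases n)
    case (Suc k)
    have "1 - q * q ^ k \<noteq> 0" using power_neq_1[OF q, of "Suc k"] by simp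
    then have "fps_nth (qbin q u w) (Suc k) * (1 - q * q ^ k) = fps_nth (qbin q u w) k * (w - u * q ^ k)"
      by (simp add: qbin_def)
    then show ?thesis by (simp add: Suc left_diff_distrib mult.assoc) (simp add: algebra_simps)
  qed simp
qed

lemma qbin_shift:
  assumes q: "norm q < 1" "q \<noteq> 0"
  shows "qbin q u w = (1 - fps_const u * fps_X) * (1 - fps_const (w / q) * fps_X) * qbin q (q * u) (w / q)"
    (is "_ = ?K")
proof (rule sym, rule qbin_unique)
  have "qdil q ?K = (1 - fps_const (q * u) * fps_X) * (1 - fps_const w * fps_X) * qdil q (qbin q (q * u) (w / q))"
    using q by (simp add: qdil_linear del: qdil_diff)
  also have "\<dots> = (1 - fps_const w * fps_X) * (1 - fps_const (w / q) * fps_X) * qbin q (q * u) (w / q)"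
    using qbin_eq[OF q(1), of "q * u" "w / q"] by (simp add: mult_ac)
  finally show "(1 - fps_const u * fps_X) * qdil q ?K = (1 - fps_const w * fps_X) * ?K"
    by (simp add: mult_ac)
qed (use q in simp_all)

section \<open>Taylor expansion of quotients of infinite products\<close>

lemma fps_expansion_qpoch_inf:
  assumes q: "norm q < 1"
  defines "P \<equiv> \<lambda>u. fps_expansion (\<lambda>x. qpoch_inf (u * x) q) 0"
  shows "(\<lambda>x. qpoch_inf (u * x) q) has_fps_expansion P u" "fps_nth (P u) 0 = 1"
    "(1 - fps_const u * fps_X) * qdil q (P u) = P u"
proof -
  have "(\<lambda>x. qpoch_inf (u * x) q) holomorphic_on UNIV"
    using holomorphic_on_compose_gen[OF _ holomorphic_qpoch_inf[OF q], of "\<lambda>x. u * x" UNIV]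
    by (auto simp: o_def intro!: holomorphic_intros)
  then show e: "(\<lambda>x. qpoch_inf (u * x) q) has_fps_expansion P u"
    unfolding P_def by (intro analytic_at_imp_has_fps_expansion_0) (auto simp: analytic_on_holomorphic)
  show "fps_nth (P u) 0 = 1" by (simp add: P_def fps_expansion_def)
  \<comment> \<open>The recursion of the product is read as a composition with
    \<open>x \<mapsto> q x\<close>; uniqueness of expansions then carries it over to power
    series.\<close>
  have "(\<lambda>x. (1 - u * x) * ((\<lambda>x. qpoch_inf (u * x) q) \<circ> (\<lambda>x. q * x)) x)
          has_fps_expansion (1 - fps_const u * fps_X) * qdil q (P u)"
    unfolding qdil_def by (intro fps_expansion_intros has_fps_expansion_compose e) simp
  moreover have "(\<lambda>x. (1 - u * x) * ((\<lambda>x. qpoch_inf (u * x) q) \<circ> (\<lambda>x. q * x)) x) =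
      (\<lambda>x. qpoch_inf (u * x) q)"
    by (rule ext) (subst (2) qpoch_inf_rec[OF q], simp add: mult_ac)
  ultimately show "(1 - fps_const u * fps_X) * qdil q (P u) = P u"
    using e by (metis fps_expansion_unique_complex)
qed

lemma fps_expansion_qpoch_inf_quotient:
  assumes q: "norm q < 1"
  shows "fps_expansion (\<lambda>x. qpoch_inf (u * x) q / qpoch_inf (w * x) q) 0 = qbin q u w"
proof -
  define P where "P u = fps_expansion (\<lambda>x. qpoch_inf (u * x) q) 0" for u
  note P = fps_expansion_qpoch_inf[OF q, folded P_def]
  have "(\<lambda>x. qpoch_inf (u * x) q / qpoch_inf (w * x) q) has_fps_expansion P u / P w"
    by (intro has_fps_expansion_divide' P) (simp add: P)
  then have "fps_expansion (\<lambda>x. qpoch_inf (u * x) q / qpoch_inf (w * x) q) 0 = P u / P w"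
    by (rule fps_expansion_eqI)
  also have "\<dots> = qbin q u w"
  proof (rule qbin_unique[OF q])
    have dvd: "P w dvd P u" by (rule fps_unit_dvd) (simp add: P)
    show "fps_nth (P u / P w) 0 = 1" by (simp add: fps_divide_unit P)
    define K where "K = P u / P w"
    have K: "K * P w = P u" using dvd by (simp add: K_def)
    have nz: "P w \<noteq> 0" "qdil q (P w) \<noteq> 0" using P(2)[of w]
      by (auto dest!: arg_cong[where f = "\<lambda>F. fps_nth F 0"])
    \<comment> \<open>Multiplying by \<open>qdil q (P w)\<close> avoids dilating a quotient; this
      nonzero factor is cancelled at the end.\<close>
    have "(1 - fps_const u * fps_X) * qdil q K * qdil q (P w) = (1 - fps_const u * fps_X) * qdil q (P u)"
      by (simp flip: K)
    also have "\<dots> = P u" by (rule P)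
    also have "\<dots> = K * ((1 - fps_const w * fps_X) * qdil q (P w))" by (simp only: K P)
    finally show "(1 - fps_const u * fps_X) * qdil q (P u / P w) = (1 - fps_const w * fps_X) * (P u / P w)"
      using nz by (simp flip: K_def add: mult_ac)
  qed
  finally show ?thesis .
qed

subsection \<open>The Askey-Wilson operator with denominators cleared\<close>

text \<open>
  \<open>aw_cleared\<close> is \<open>D - e\<close> multiplied by the common denominator \<open>(1 - x\<^sup>2) (1 - qx\<^sup>2) (q - x\<^sup>2)\<close>, so that
  it maps power series to power series.
\<close>

definition aw_num_pos :: "complex \<Rightarrow> complex \<Rightarrow> complex \<Rightarrow> complex \<Rightarrow> complex \<Rightarrow> complex fps" where
  "aw_num_pos a b c d q = (let x = fps_X; k = fps_const in
    (k q - x\<^sup>2) * ((1 - k a * x) * (1 - k b * x) * (1 - k c * x) * (1 - k d * x)))"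

definition aw_num_neg :: "complex \<Rightarrow> complex \<Rightarrow> complex \<Rightarrow> complex \<Rightarrow> complex \<Rightarrow> complex fps" where
  "aw_num_neg a b c d q = (let x = fps_X; k = fps_const in
    (1 - k q * x\<^sup>2) * ((x - k a) * (x - k b) * (x - k c) * (x - k d)))"

definition aw_denom :: "complex \<Rightarrow> complex fps" where
  "aw_denom q = (1 - fps_X\<^sup>2) * (1 - fps_const q * fps_X\<^sup>2) * (fps_const q - fps_X\<^sup>2)"

definition aw_cleared ::
  "complex \<Rightarrow> complex \<Rightarrow> complex \<Rightarrow> complex \<Rightarrow> complex \<Rightarrow> complex \<Rightarrow> complex \<Rightarrow> complex fps \<Rightarrow> complex fps"
where
  "aw_cleared a b c d q s e F =
    aw_num_pos a b c d q * (fps_const s * qdil q F - F)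
    + aw_num_neg a b c d q * (fps_const (1 / s) * qdil (1 / q) F - F)
    - aw_denom q * (fps_const e * F)"

abbreviation aw_eigenvalue :: "complex \<Rightarrow> complex \<Rightarrow> complex \<Rightarrow> complex \<Rightarrow> complex \<Rightarrow> complex \<Rightarrow> complex" where
  "aw_eigenvalue a b c d q s \<equiv> s + a * b * c * d / (q * s) - 1 - a * b * c * d / q"

lemma aw_cleared_diff:
  "aw_cleared a b c d q s e (F - G) = aw_cleared a b c d q s e F - aw_cleared a b c d q s e G"
  by (simp add: aw_cleared_def algebra_simps)

lemma aw_cleared_add:
  "aw_cleared a b c d q s e (F + G) = aw_cleared a b c d q s e F + aw_cleared a b c d q s e G"
  by (simp add: aw_cleared_def algebra_simps)

lemma aw_cleared_cmult:
  "aw_cleared a b c d q s e (fps_const h * F) = fps_const h * aw_cleared a b c d q s e F"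
  by (simp add: aw_cleared_def algebra_simps)

text \<open>Passes from the eigenvalue natural to a single basis series to the eigenvalue of the
  solution.\<close>

lemma aw_cleared_eigenvalue_diff:
  "aw_cleared a b c d q s e F =
    aw_cleared a b c d q s e' F + aw_denom q * (fps_const (e' - e) * F)"
  unfolding aw_cleared_def fps_const_sub[symmetric] by algebra

text \<open>Extending the second coefficient by \<open>x^4\<close> turns its denominator into
  \<open>(1 - x^2) (q - x^2)\<close>, so the three factors form a common denominator.\<close>

lemma aw_coefficients_clear:
  fixes x :: "'a :: field"
  assumes "x \<noteq> 0" "1 - x\<^sup>2 \<noteq> 0" "1 - q * x\<^sup>2 \<noteq> 0" "q - x\<^sup>2 \<noteq> 0"
  shows "(1 - a * x) * (1 - b * x) * (1 - c * x) * (1 - d * x) / ((1 - x\<^sup>2) * (1 - q * x\<^sup>2)) * U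
    + (1 - a / x) * (1 - b / x) * (1 - c / x) * (1 - d / x) / ((1 - 1 / x\<^sup>2) * (1 - q / x\<^sup>2)) * V = W \<longleftrightarrow>
    (q - x\<^sup>2) * ((1 - a * x) * (1 - b * x) * (1 - c * x) * (1 - d * x)) * U
    + (1 - q * x\<^sup>2) * ((x - a) * (x - b) * (x - c) * (x - d)) * V
    - (1 - x\<^sup>2) * (1 - q * x\<^sup>2) * (q - x\<^sup>2) * W = 0" (is "?A / _ * U + ?B * V = W \<longleftrightarrow> ?rhs = 0")
proof -
  let ?D = "(1 - x\<^sup>2) * (1 - q * x\<^sup>2) * (q - x\<^sup>2)"
  have 1: "1 - y / x = (x - y) / x" for y using assms(1) by (simp add: field_simps)
  have 2: "1 - y / x\<^sup>2 = - (y - x\<^sup>2) / x\<^sup>2" for y using assms(1) by (simp add: field_simps)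
  have 3: "?B = (x - a) * (x - b) * (x - c) * (x - d) / ((1 - x\<^sup>2) * (q - x\<^sup>2))"
    unfolding 1 2 using assms by (simp add: divide_simps power2_eq_square, simp add: algebra_simps)
  have 4: "e3 * A * U + e2 * B * V - e1 * e2 * e3 * W =
      e1 * e2 * e3 * (A / (e1 * e2) * U + B / (e1 * e3) * V - W)"
    if "e1 \<noteq> 0" "e2 \<noteq> 0" "e3 \<noteq> 0" for e1 e2 e3 A B :: 'a
    using that by (simp add: field_simps)
  have "?rhs = ?D * (?A / ((1 - x\<^sup>2) * (1 - q * x\<^sup>2)) * U + ?B * V - W)"
    unfolding 3 by (rule 4[OF assms(2-4)])
  then show ?thesis using assms(2-4) by auto
qed

lemma is_aw_series_iff:
  assumes "q \<noteq> 0"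
  shows "is_aw_series a b c d q s C \<longleftrightarrow>
    fps_nth C 0 = 1 \<and> aw_cleared a b c d q s (aw_eigenvalue a b c d q s) C = 0"
proof -
  have sh: "qshift p t (fps_to_fls C) = fps_to_fls (fps_const t * qdil p C)" for p t
    by (rule fls_eqI) (simp add: qshift.rep_eq power_int_def)
  define D1 D2 D3 :: "complex fps" where
    "D1 = 1 - fps_X\<^sup>2" and "D2 = 1 - fps_const q * fps_X\<^sup>2" and "D3 = fps_const q - fps_X\<^sup>2"
  \<comment> \<open>The constant terms are 1, 1 and \<open>q\<close>.\<close>
  have "fps_nth D1 0 \<noteq> 0" "fps_nth D2 0 \<noteq> 0" "fps_nth D3 0 \<noteq> 0"
    using assms by (simp_all add: D1_def D2_def D3_def)
  then have "D1 \<noteq> 0" "D2 \<noteq> 0" "D3 \<noteq> 0" by auto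
  then have "fps_to_fls D1 \<noteq> 0" "fps_to_fls D2 \<noteq> 0" "fps_to_fls D3 \<noteq> 0"
    by (simp_all only: fps_to_fls_eq_0_iff not_False_eq_True)
  then have nz: "1 - fls_X\<^sup>2 \<noteq> (0 :: complex fls)" "1 - fls_const q * fls_X\<^sup>2 \<noteq> 0"
     "fls_const q - fls_X\<^sup>2 \<noteq> 0"
    by (simp_all only: D1_def D2_def D3_def fps_to_fls_minus fps_one_to_fls fps_to_fls_power
        fls_times_fps_to_fls fps_const_to_fls fps_X_to_fls not_False_eq_True)
  show ?thesis
    unfolding is_aw_series_def askey_wilson_def Let_def sh aw_coefficients_clear[OF fls_X_nonzero nz]
    by (subst fps_to_fls_eq_0_iff[symmetric])
       (simp only: aw_cleared_def aw_num_pos_def aw_num_neg_def aw_denom_def Let_def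
        fps_to_fls_minus fps_to_fls_plus fps_one_to_fls fps_to_fls_power
        fls_times_fps_to_fls fps_const_to_fls fps_X_to_fls)
qed

section \<open>Lowest coefficients and uniqueness\<close>

lemma fps_mult_nth_lowest:
  fixes P F :: "'a :: semiring_0 fps"
  assumes "\<And>k. k < n \<Longrightarrow> fps_nth F k = 0"
  shows "fps_nth (P * F) n = fps_nth P 0 * fps_nth F n"
proof -
  have "fps_nth (P * F) n = (\<Sum>i=0..n. fps_nth P i * fps_nth F (n - i))"
    by (rule fps_mult_nth)
  also have "\<dots> = (\<Sum>i\<in>{0}. fps_nth P i * fps_nth F (n - i))"
    using assms by (intro sum.mono_neutral_right) (auto simp: diff_less)
  finally show ?thesis by simp
qed

text \<open>Only the constant terms \<open>q\<close>, \<open>a b c d\<close> and \<open>q\<close> of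
  the three multipliers contribute. The resulting factor is \<open>q\<close> times
  \<open>E(s q^n) - e\<close>.\<close>

lemma aw_cleared_nth_lowest:
  assumes "\<And>k. k < n \<Longrightarrow> fps_nth F k = 0"
  shows "fps_nth (aw_cleared a b c d q s e F) n =
    (q * (s * q ^ n - 1) + a * b * c * d * (1 / (s * q ^ n) - 1) - q * e) * fps_nth F n"
  unfolding aw_cleared_def fps_sub_nth fps_add_nth
  by (subst (1 2 3) fps_mult_nth_lowest)
    (simp_all add: assms aw_num_pos_def aw_num_neg_def aw_denom_def algebra_simps power_divide)

lemma aw_cleared_inj:
  assumes q: "norm q < 1" "q \<noteq> 0" and s: "s \<noteq> 0"
    and gen: "\<And>n::nat. n \<ge> 2 \<Longrightarrow> q ^ n * s ^ 2 \<noteq> a * b * c * d"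
    and F: "aw_cleared a b c d q s (aw_eigenvalue a b c d q s) F = 0" "fps_nth F 0 = 0"
  shows "F = 0"
proof -
  have "fps_nth F n = 0" for n
  proof (induction n rule: less_induct)
    case (less n)
    show ?case
    proof (cases "n = 0")
      case False
      let ?p = "a * b * c * d"
      let ?e = "q * (s * q ^ n - 1) + ?p * (1 / (s * q ^ n) - 1) - q * aw_eigenvalue a b c d q s"
      have "?e * fps_nth F n = 0"
        using aw_cleared_nth_lowest[of n F a b c d q s "aw_eigenvalue a b c d q s"] less F(1) by simp
      \<comment> \<open>Since \<open>n \<ge> 1\<close>, the exponent \<open>Suc n\<close> is at
        least 2, which is the range of the genericity condition.\<close>
      moreover have "?e * (s * q ^ n) = (1 - q ^ n) * (?p - q ^ Suc n * s\<^sup>2)"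
        using q s by (simp add: field_simps power2_eq_square)
      moreover have "q ^ n \<noteq> 1" "?p \<noteq> q ^ Suc n * s\<^sup>2"
        using power_neq_1[OF q(1)] False gen[of "Suc n"] by auto
      ultimately show ?thesis by auto
    qed (simp add: F)
  qed
  then show ?thesis by (simp add: fps_eq_iff)
qed

lemma aw_two_term_identity:
  fixes x :: "'a :: idom"
  assumes "u * v = 1"
  shows "(1 - b * x) * (1 - c * x) * (1 - d * x) * (1 - u * x) + u * ((x - b) * (x - c) * (x - d)) * (1 - v * x) =
    (1 - x\<^sup>2) * ((1 - u * b * c * d) * ((1 - v * x) * (1 - u * x)) + v * (1 - u * b) * (1 - u * c) * (1 - u * d) * x)"
  using assms by algebra

text \<open>\<open>U\<close> and \<open>V\<close> stand for the forward and backward differences of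
  \<open>\<phi>\<close>, and \<open>\<psi>\<close> for the next basis series.\<close>

lemma aw_two_term_ring:
  fixes x :: "'a :: idom"
  assumes uv: "u * v = 1" and nz: "(1 - v * x) * (1 - u * x) \<noteq> 0"
    and U: "(1 - a * x) * (1 - v * x) * U = (t - 1) * (1 - q * x\<^sup>2) * \<phi>"
    and V: "(a - x) * (1 - u * x) * V = (1 - t) * u * (q - x\<^sup>2) * \<phi>"
    and \<psi>: "x * \<phi> = (1 - v * x) * (1 - u * x) * \<psi>"
  shows "(q - x\<^sup>2) * ((1 - a * x) * (1 - b * x) * (1 - c * x) * (1 - d * x)) * U
    + (1 - q * x\<^sup>2) * ((x - a) * (x - b) * (x - c) * (x - d)) * V =
    (1 - x\<^sup>2) * (1 - q * x\<^sup>2) * (q - x\<^sup>2) *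
      ((t - 1) * ((1 - u * b * c * d) * \<phi> + v * (1 - u * b) * (1 - u * c) * (1 - u * d) * \<psi>))"
    (is "?l = ?r")
proof -
  let ?w = "(1 - v * x) * (1 - u * x)" and ?y = "(x - b) * (x - c) * (x - d)"
    and ?z = "(1 - b * x) * (1 - c * x) * (1 - d * x)"
  \<comment> \<open>The factor \<open>?w\<close> supplies what is needed to insert \<open>U\<close>
    and \<open>V\<close> without division; the factors with \<open>a\<close> disappear.\<close>
  have "?l * ?w = (q - x\<^sup>2) * ?z * (1 - u * x) * ((1 - a * x) * (1 - v * x) * U)
      - (1 - q * x\<^sup>2) * ?y * (1 - v * x) * ((a - x) * (1 - u * x) * V)"
    by algebra
  also have "\<dots> = (q - x\<^sup>2) * (1 - q * x\<^sup>2) * (t - 1) * \<phi> * (?z * (1 - u * x) + u * ?y * (1 - v * x))"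
    unfolding U V by algebra
  also have "\<dots> = (q - x\<^sup>2) * (1 - q * x\<^sup>2) * (t - 1) * (1 - x\<^sup>2) *
      ((1 - u * b * c * d) * (?w * \<phi>) + v * (1 - u * b) * (1 - u * c) * (1 - u * d) * (x * \<phi>))"
    unfolding aw_two_term_identity[OF uv] by algebra
  also have "\<dots> = ?r * ?w"
    unfolding \<psi> by algebra
  finally show ?thesis using nz by simp
qed

subsection \<open>Two-term action on the shifted factorials\<close>

text \<open>This is \<open>\<phi>\<^sub>m\<close>, with the prefactor common to all \<open>m\<close>
  split off on the left.\<close>

definition aw_basis :: "complex \<Rightarrow> complex \<Rightarrow> complex \<Rightarrow> nat \<Rightarrow> complex fps" where
  "aw_basis a q s m =
    qbin q a (q / a) * (fps_X ^ m * qbin q (q * (s * q ^ m) / a) (a / (s * q ^ m)))"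

lemma aw_basis_nth_eq_0: "n < m \<Longrightarrow> fps_nth (aw_basis a q s m) n = 0"
  by (simp add: aw_basis_def fps_X_power_mult_nth mult.left_commute[of _ "fps_X ^ m"])

lemma fps_linear_neq_0: "(1 - fps_const u * fps_X :: complex fps) \<noteq> 0"
proof
  assume "(1 - fps_const u * fps_X :: complex fps) = 0"
  then have "fps_nth (1 - fps_const u * fps_X :: complex fps) 0 = 0" by simp
  then show False by simp
qed

lemma qbin_eq_inverse:
  assumes q: "norm q < 1" "q \<noteq> 0"
  shows "(1 - fps_const (w / q) * fps_X) * qdil (1 / q) (qbin q u w) =
    (1 - fps_const (u / q) * fps_X) * qbin q u w"
  using arg_cong[OF qbin_eq[OF q(1), of u w], of "qdil (1 / q)"] q
  by (simp add: qdil_linear qdil_qdil del: qdil_diff)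

text \<open>Raising \<open>m\<close> by one replaces \<open>t\<close> by \<open>q t\<close>, which
  moves one factor in each infinite product of the second \<open>qbin\<close>.\<close>

lemma aw_basis_shift:
  assumes q: "norm q < 1" "q \<noteq> 0"
    and t: "t = s * q ^ m"
  shows "fps_X * aw_basis a q s m =
    (1 - fps_const (q * t / a) * fps_X) * (1 - fps_const (a / (q * t)) * fps_X) * aw_basis a q s (Suc m)"
proof -
  have "qbin q (q * t / a) (a / t) =
     (1 - fps_const (q * t / a) * fps_X) * (1 - fps_const (a / (q * t)) * fps_X) *
     qbin q (q * (q * t) / a) (a / (q * t))"
    using qbin_shift[OF q, of "q * t / a" "a / t"] by (simp add: mult_ac)
  then show ?thesis by (simp add: aw_basis_def t mult_ac)
qed

text \<open>The linear terms cancel because \<open>t p = v\<close> and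
  \<open>t r = a\<close>.\<close>

lemma aw_dilate_identity:
  fixes x :: "'a :: comm_ring_1"
  assumes "v = t * p" "a = t * r" "q = p * t * r"
  shows "t * (1 - p * x) * (1 - r * x) - (1 - a * x) * (1 - v * x) = (t - 1) * (1 - q * x\<^sup>2)"
  unfolding assms by (simp add: algebra_simps power2_eq_square)

text \<open>Both \<open>qbin\<close> factors satisfy first-order equations, so dilating the basis
  series multiplies it by a rational function. Subtracting 1 from that function (scaled by
  \<open>s\<close> or \<open>1 / s\<close>) produces the factor \<open>1 - q x^2\<close> or
  \<open>q - x^2\<close> of the operator's denominators.\<close>

lemma aw_basis_dilate:
  assumes q: "norm q < 1" "q \<noteq> 0" and nz: "a \<noteq> 0" "s \<noteq> 0"
    and t: "t = s * q ^ m"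
  shows "(1 - fps_const a * fps_X) * (1 - fps_const (q * t / a) * fps_X) *
      (fps_const s * qdil q (aw_basis a q s m) - aw_basis a q s m) =
    (fps_const t - 1) * (1 - fps_const q * fps_X\<^sup>2) * aw_basis a q s m" (is ?th1)
  and "(fps_const a - fps_X) * (1 - fps_const (a / (q * t)) * fps_X) *
      (fps_const (1 / s) * qdil (1 / q) (aw_basis a q s m) - aw_basis a q s m) =
    (1 - fps_const t) * fps_const (a / (q * t)) * (fps_const q - fps_X\<^sup>2) * aw_basis a q s m" (is ?th2)
proof -
  let ?\<phi> = "aw_basis a q s m" and ?k = "fps_const :: complex \<Rightarrow> complex fps" and ?x = "fps_X :: complex fps"
  define G where "G = qbin q a (q / a)"
  define H where "H = qbin q (q * t / a) (a / t)"
  have \<phi>: "?\<phi> = G * (?x ^ m * H)" by (simp add: aw_basis_def G_def H_def t)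
  have t0: "t \<noteq> 0" using nz q by (simp add: t)
  have G: "(1 - ?k a * ?x) * qdil q G = (1 - ?k (q / a) * ?x) * G"
    and H: "(1 - ?k (q * t / a) * ?x) * qdil q H = (1 - ?k (a / t) * ?x) * H"
    unfolding G_def H_def by (rule qbin_eq[OF q(1)])+
  have "(1 - ?k a * ?x) * (1 - ?k (q * t / a) * ?x) * (?k s * qdil q ?\<phi>) =
      ?k t * ?x ^ m * ((1 - ?k a * ?x) * qdil q G) * ((1 - ?k (q * t / a) * ?x) * qdil q H)"
    by (simp add: \<phi> t mult_ac flip: fps_const_mult)
  also have "\<dots> = ?k t * (1 - ?k (q / a) * ?x) * (1 - ?k (a / t) * ?x) * ?\<phi>"
    unfolding G H by (simp add: \<phi> mult_ac)
  finally have "(1 - ?k a * ?x) * (1 - ?k (q * t / a) * ?x) * (?k s * qdil q ?\<phi> - ?\<phi>) =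
     (?k t * (1 - ?k (q / a) * ?x) * (1 - ?k (a / t) * ?x) - (1 - ?k a * ?x) * (1 - ?k (q * t / a) * ?x)) * ?\<phi>"
    by (simp only: right_diff_distrib left_diff_distrib)
  also have "?k t * (1 - ?k (q / a) * ?x) * (1 - ?k (a / t) * ?x) - (1 - ?k a * ?x) * (1 - ?k (q * t / a) * ?x)
     = (?k t - 1) * (1 - ?k q * ?x\<^sup>2)"
    by (rule aw_dilate_identity) (use nz t0 in simp_all)
  finally show ?th1 .
  have "(1 - ?k (q / a / q) * ?x) * qdil (1 / q) G = (1 - ?k (a / q) * ?x) * G"
    and "(1 - ?k (a / t / q) * ?x) * qdil (1 / q) H = (1 - ?k (q * t / a / q) * ?x) * H"
    unfolding G_def H_def by (rule qbin_eq_inverse[OF q])+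
  then have G: "(1 - ?k (1 / a) * ?x) * qdil (1 / q) G = (1 - ?k (a / q) * ?x) * G"
    and H: "(1 - ?k (a / (q * t)) * ?x) * qdil (1 / q) H = (1 - ?k (t / a) * ?x) * H"
    using q nz by (simp_all add: mult.commute)
  \<comment> \<open>Exposes the factor \<open>1 - x / a\<close> on which the inverse dilation
    equation of \<open>G\<close> acts.\<close>
  have a: "?k a - ?x = ?k a * (1 - ?k (1 / a) * ?x)"
    using nz by (simp add: right_diff_distrib flip: mult.assoc)
  have X: "?k (1 / s) * qdil (1 / q) (?x ^ m) = ?k (1 / t) * ?x ^ m"
    by (simp add: t power_divide flip: mult.assoc)
  have "(?k a - ?x) * (1 - ?k (a / (q * t)) * ?x) * (?k (1 / s) * qdil (1 / q) ?\<phi>) =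
      ?k a * (?k (1 / s) * qdil (1 / q) (?x ^ m)) * ((1 - ?k (1 / a) * ?x) * qdil (1 / q) G) *
        ((1 - ?k (a / (q * t)) * ?x) * qdil (1 / q) H)"
    unfolding a \<phi> qdil_mult by (simp only: mult_ac)
  also have "\<dots> = ?k a * ?k (1 / t) * (1 - ?k (a / q) * ?x) * (1 - ?k (t / a) * ?x) * ?\<phi>"
    unfolding G H X \<phi> by (simp only: mult_ac)
  finally have "(?k a - ?x) * (1 - ?k (a / (q * t)) * ?x) * (?k (1 / s) * qdil (1 / q) ?\<phi> - ?\<phi>) =
     (?k a * ?k (1 / t) * (1 - ?k (a / q) * ?x) * (1 - ?k (t / a) * ?x)
       - (?k a - ?x) * (1 - ?k (a / (q * t)) * ?x)) * ?\<phi>"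
    by (simp only: right_diff_distrib left_diff_distrib)
  also have "?k a * ?k (1 / t) * (1 - ?k (a / q) * ?x) * (1 - ?k (t / a) * ?x)
       - (?k a - ?x) * (1 - ?k (a / (q * t)) * ?x)
     = (1 - ?k t) * ?k (a / (q * t)) * (?k q - ?x\<^sup>2)"
  proof -
    have "?k t * ?k (1 / t) = 1" "?k a * ?k (1 / t) = ?k q * ?k (a / (q * t))"
      "?k (a / q) = ?k t * ?k (a / (q * t))" "?k a * ?k (t / a) = ?k t"
      using nz t0 q by simp_all
    then show ?thesis by algebra
  qed
  finally show ?th2 .
qed

text \<open>With the eigenvalue of \<open>t\<close> the two-term action loses its diagonal term,
  leaving only the next basis series.\<close>

lemma aw_cleared_basis:
  assumes q: "norm q < 1" "q \<noteq> 0" and nz: "a \<noteq> 0" "s \<noteq> 0"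
    and t: "t = s * q ^ m" and u: "u = a / (q * t)"
  shows "aw_cleared a b c d q s (aw_eigenvalue a b c d q t) (aw_basis a q s m) =
    aw_denom q *
    (fps_const ((t - 1) * ((1 - u * b) * (1 - u * c) * (1 - u * d) / u)) * aw_basis a q s (Suc m))"
proof -
  let ?k = "fps_const :: complex \<Rightarrow> complex fps" and ?x = "fps_X :: complex fps"
  have t0: "t \<noteq> 0" and v: "q * t / a = 1 / u" and u0: "u \<noteq> 0"
    using nz q by (auto simp: t u)
  note B = aw_basis_dilate[OF q nz t, folded u, unfolded v]
  note S = aw_basis_shift[OF q t, of a, folded u, unfolded v]
  have *: "aw_num_pos a b c d q * (?k s * qdil q (aw_basis a q s m) - aw_basis a q s m)
    + aw_num_neg a b c d q * (?k (1 / s) * qdil (1 / q) (aw_basis a q s m) - aw_basis a q s m) =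
    aw_denom q *
      ((?k t - 1) * ((1 - ?k u * ?k b * ?k c * ?k d) * aw_basis a q s m +
        ?k (1 / u) * (1 - ?k u * ?k b) * (1 - ?k u * ?k c) * (1 - ?k u * ?k d) * aw_basis a q s (Suc m)))"
    unfolding aw_num_pos_def aw_num_neg_def aw_denom_def Let_def
    by (rule aw_two_term_ring[OF _ _ B S]) (use u0 in \<open>simp_all add: fps_linear_neq_0\<close>)
  \<comment> \<open>This factorization is exactly the diagonal coefficient of the two-term
    formula.\<close>
  have e: "aw_eigenvalue a b c d q t = (t - 1) * (1 - u * b * c * d)"
    using t0 q by (simp add: u field_simps)
  have k: "?k (aw_eigenvalue a b c d q t) = (?k t - 1) * (1 - ?k u * ?k b * ?k c * ?k d)"
    and k2: "?k ((t - 1) * ((1 - u * b) * (1 - u * c) * (1 - u * d) / u)) =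
      (?k t - 1) * (?k (1 / u) * (1 - ?k u * ?k b) * (1 - ?k u * ?k c) * (1 - ?k u * ?k d))"
    unfolding e by (simp_all flip: fps_const_1_eq_1)
  have "D * (T * (A * F + B * G)) - D * (T * A * F) = D * (T * B * G)" for A B D F G T :: "complex fps"
    by (simp add: ring_distribs mult.assoc)
  then show ?thesis
    unfolding aw_cleared_def * k k2 .
qed

subsection \<open>The series solution\<close>

definition aw_ratio :: "complex \<Rightarrow> complex \<Rightarrow> complex \<Rightarrow> complex \<Rightarrow> complex \<Rightarrow> complex \<Rightarrow> nat \<Rightarrow> complex" where
  "aw_ratio a b c d q s i = (let t = s * q ^ i in
    - (1 - t) * (1 - q * t / (a * b)) * (1 - q * t / (a * c)) * (1 - q * t / (a * d)) * (a / t)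
    / ((1 - q ^ Suc i) * (1 - q ^ (i + 2) * s\<^sup>2 / (a * b * c * d))))"

definition aw_coeff :: "complex \<Rightarrow> complex \<Rightarrow> complex \<Rightarrow> complex \<Rightarrow> complex \<Rightarrow> complex \<Rightarrow> nat \<Rightarrow> complex" where
  "aw_coeff a b c d q s m = (\<Prod>i<m. aw_ratio a b c d q s i)"

lemma aw_ratio_eq:
  assumes q: "norm q < 1" "q \<noteq> 0" and nz: "a \<noteq> 0" "b \<noteq> 0" "c \<noteq> 0" "d \<noteq> 0" "s \<noteq> 0"
    and gen: "\<And>n::nat. n \<ge> 2 \<Longrightarrow> q ^ n * s ^ 2 \<noteq> a * b * c * d"
    and t: "t = s * q ^ m" and u: "u = a / (q * t)"
  shows "aw_ratio a b c d q s m * (aw_eigenvalue a b c d q (s * q ^ Suc m) - aw_eigenvalue a b c d q s) =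
    - ((t - 1) * ((1 - u * b) * (1 - u * c) * (1 - u * d) / u))"
proof -
  have t0: "t \<noteq> 0" using nz q by (simp add: t)
  let ?p = "a * b * c * d"
  have u0: "u \<noteq> 0" using nz t0 q by (simp add: u)
  have f: "1 - q * t / (a * y) = - (1 - u * y) / (u * y)" if "y \<noteq> 0" for y
    using that t0 nz q by (simp add: u field_simps)
  have n1: "1 - q ^ Suc m \<noteq> 0" using power_neq_1[OF q(1), of "Suc m"] by simp
  have n2: "1 - q ^ (m + 2) * s\<^sup>2 / ?p \<noteq> 0" using gen[of "m + 2"] nz by (simp add: field_simps)
  \<comment> \<open>The first two factors are the denominators of \<open>aw_ratio\<close>.\<close>
  have e: "aw_eigenvalue a b c d q (s * q ^ Suc m) - aw_eigenvalue a b c d q s =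
      (1 - q ^ Suc m) * (1 - q ^ (m + 2) * s\<^sup>2 / ?p) * (?p / (q\<^sup>2 * t))"
    using q nz by (simp add: t field_simps power2_eq_square)
  have cancel: "x / (y * z) * (y * z * w) = x * w" if "y \<noteq> 0" "z \<noteq> 0" for x y z w :: complex
    using that by simp
  have "aw_ratio a b c d q s m * (aw_eigenvalue a b c d q (s * q ^ Suc m) - aw_eigenvalue a b c d q s) =
      - (1 - t) * (1 - q * t / (a * b)) * (1 - q * t / (a * c)) * (1 - q * t / (a * d)) * (a / t) * (?p / (q\<^sup>2 * t))"
    unfolding e aw_ratio_def Let_def t[symmetric] by (rule cancel[OF n1 n2])
  also have "(1 - q * t / (a * b)) = - (1 - u * b) / (u * b)" using nz by (intro f)
  also have "(1 - q * t / (a * c)) = - (1 - u * c) / (u * c)" using nz by (intro f)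
  also have "(1 - q * t / (a * d)) = - (1 - u * d) / (u * d)" using nz by (intro f)
  \<comment> \<open>The three signs combine and \<open>b c d\<close> cancels; since
    \<open>a / (q t) = u\<close>, the remaining \<open>u^2 / u^3\<close> is the wanted
    \<open>1 / u\<close>.\<close>
  also have "- (1 - t) * (- (1 - u * b) / (u * b)) * (- (1 - u * c) / (u * c)) * (- (1 - u * d) / (u * d)) *
      (a / t) * (?p / (q\<^sup>2 * t)) =
     (1 - t) * ((1 - u * b) * (1 - u * c) * (1 - u * d)) * ((a / (q * t))\<^sup>2 / u ^ 3)"
    using nz u0 t0 q by (simp add: divide_simps power2_eq_square power3_eq_cube) algebra
  also have "\<dots> = - ((t - 1) * ((1 - u * b) * (1 - u * c) * (1 - u * d) / u))"
    unfolding u[symmetric] using u0 by (simp add: divide_simps power2_eq_square power3_eq_cube) algebra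
  finally show ?thesis .
qed

text \<open>The sum telescopes: by the recursion for \<open>h\<close>, each raised term cancels the
  next diagonal term, so only a multiple of the \<open>N\<close>-th basis series survives.\<close>

lemma aw_cleared_partial_sum:
  assumes q: "norm q < 1" "q \<noteq> 0" and nz: "a \<noteq> 0" "b \<noteq> 0" "c \<noteq> 0" "d \<noteq> 0" "s \<noteq> 0"
    and gen: "\<And>n::nat. n \<ge> 2 \<Longrightarrow> q ^ n * s ^ 2 \<noteq> a * b * c * d"
  shows "aw_cleared a b c d q s (aw_eigenvalue a b c d q s)
      (\<Sum>m<N. fps_const (aw_coeff a b c d q s m) * aw_basis a q s m) =
    - (aw_denom q *
      (fps_const (aw_coeff a b c d q s N *
        (aw_eigenvalue a b c d q (s * q ^ N) - aw_eigenvalue a b c d q s)) * aw_basis a q s N))"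
proof (induction N)
  case 0
  \<comment> \<open>The empty sum is mapped to 0, and the eigenvalue difference is 0 since
    \<open>q ^ 0 = 1\<close>.\<close>
  show ?case using aw_cleared_diff[of a b c d q s _ 0 0] by simp
next
  case (Suc N)
  let ?D = "aw_denom q" and ?L = "aw_cleared a b c d q s (aw_eigenvalue a b c d q s)"
  let ?k = "fps_const :: complex \<Rightarrow> complex fps"
  let ?h = "aw_coeff a b c d q s" and ?E = "\<lambda>n. aw_eigenvalue a b c d q (s * q ^ n)"
  define g where "g = (let t = s * q ^ N; u = a / (q * t) in
    (t - 1) * ((1 - u * b) * (1 - u * c) * (1 - u * d) / u))"
  have r: "aw_ratio a b c d q s N * (?E (Suc N) - aw_eigenvalue a b c d q s) = - g"
    unfolding g_def Let_def by (rule aw_ratio_eq[OF q nz gen refl refl])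
  have "?L (aw_basis a q s N) =
      ?D * (?k g * aw_basis a q s (Suc N)) + ?D * (?k (?E N - aw_eigenvalue a b c d q s) * aw_basis a q s N)"
    unfolding aw_cleared_eigenvalue_diff[of _ _ _ _ _ _ "aw_eigenvalue a b c d q s" _ "?E N"]
      aw_cleared_basis[OF q nz(1,5) refl refl] g_def Let_def ..
  moreover have "?L (\<Sum>m<Suc N. ?k (?h m) * aw_basis a q s m) =
      ?L (\<Sum>m<N. ?k (?h m) * aw_basis a q s m) + ?k (?h N) * ?L (aw_basis a q s N)"
    by (simp add: aw_cleared_add aw_cleared_cmult)
  ultimately have "?L (\<Sum>m<Suc N. ?k (?h m) * aw_basis a q s m) =
      ?D * (?k (?h N * g) * aw_basis a q s (Suc N))"
    unfolding Suc fps_const_mult[symmetric] by algebra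
  also have "?h N * g = - (?h (Suc N) * (?E (Suc N) - aw_eigenvalue a b c d q s))"
    using r by (simp add: aw_coeff_def mult.assoc)
  finally show ?case by (simp flip: fps_const_neg)
qed

text \<open>The infinite sum over \<open>m\<close> without the prefactor; the factor
  \<open>x^m\<close> makes each coefficient a finite sum.\<close>

definition aw_series :: "complex \<Rightarrow> complex \<Rightarrow> complex \<Rightarrow> complex \<Rightarrow> complex \<Rightarrow> complex \<Rightarrow> complex fps" where
  "aw_series a b c d q s = Abs_fps (\<lambda>n. \<Sum>m\<le>n. aw_coeff a b c d q s m *
     fps_nth (qbin q (q * (s * q ^ m) / a) (a / (s * q ^ m))) (n - m))"

lemma aw_series_nth:
  assumes "n < N"
  shows "fps_nth (qbin q a (q / a) * aw_series a b c d q s) n =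
    fps_nth (\<Sum>m<N. fps_const (aw_coeff a b c d q s m) * aw_basis a q s m) n"
proof -
  define S where "S = (\<Sum>m<N. fps_const (aw_coeff a b c d q s m) *
    (fps_X ^ m * qbin q (q * (s * q ^ m) / a) (a / (s * q ^ m))))"
  have S: "fps_nth (aw_series a b c d q s) k = fps_nth S k" if "k < N" for k
    unfolding S_def aw_series_def fps_sum_nth fps_nth_Abs_fps
    by (rule sum.mono_neutral_cong_left) (use that in \<open>auto simp: fps_X_power_mult_nth\<close>)
  have "(\<Sum>m<N. fps_const (aw_coeff a b c d q s m) * aw_basis a q s m) = qbin q a (q / a) * S"
    by (simp add: S_def aw_basis_def sum_distrib_left mult.left_commute)
  moreover have "fps_nth (qbin q a (q / a) * (aw_series a b c d q s - S)) n = 0"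
    using assms by (subst fps_mult_nth_lowest) (simp_all add: S)
  ultimately show ?thesis by (simp add: right_diff_distrib)
qed

lemma aw_cleared_series:
  assumes q: "norm q < 1" "q \<noteq> 0" and nz: "a \<noteq> 0" "b \<noteq> 0" "c \<noteq> 0" "d \<noteq> 0" "s \<noteq> 0"
    and gen: "\<And>n::nat. n \<ge> 2 \<Longrightarrow> q ^ n * s ^ 2 \<noteq> a * b * c * d"
  shows "aw_cleared a b c d q s (aw_eigenvalue a b c d q s) (qbin q a (q / a) * aw_series a b c d q s) = 0"
proof (rule fps_ext)
  fix n
  let ?L = "aw_cleared a b c d q s (aw_eigenvalue a b c d q s)"
  let ?F = "qbin q a (q / a) * aw_series a b c d q s"
  \<comment> \<open>With \<open>Suc n\<close> terms, the truncation agrees through degree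
    \<open>n\<close> and its residual starts in degree \<open>n + 1\<close>.\<close>
  define F where "F = (\<Sum>m<Suc n. fps_const (aw_coeff a b c d q s m) * aw_basis a q s m)"
  have "fps_nth (?L (?F - F)) n = 0"
    by (subst aw_cleared_nth_lowest) (simp_all add: F_def aw_series_nth[of _ "Suc n"] del: sum.lessThan_Suc)
  moreover have "fps_nth (?L F) n = 0"
    by (simp add: F_def aw_cleared_partial_sum[OF q nz gen] fps_mult_nth_lowest aw_basis_nth_eq_0
        del: sum.lessThan_Suc)
  ultimately show "fps_nth (?L ?F) n = fps_nth 0 n" by (simp add: aw_cleared_diff)
qed

subsection \<open>Identification of the coefficients\<close>

abbreviation qp :: "complex \<Rightarrow> complex \<Rightarrow> nat \<Rightarrow> complex" where
  "qp q u n \<equiv> \<Prod>i<n. 1 - q ^ i * u"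

lemma qp_add: "qp q u (m + k) = qp q u m * qp q (q ^ m * u) k"
  by (induction k) (simp_all add: power_add mult_ac)

text \<open>Pairing opposite signs gives factorials in base \<open>q^2\<close>, whose factors
  interleave. With \<open>y = s / a\<close> these are the last four lower parameters.\<close>

lemma qp_double:
  assumes "r\<^sup>2 = q"
  shows "qp q (r * y) m * qp q (- (r * y)) m * (qp q (q * y) m * qp q (- (q * y)) m) = qp q (q * y\<^sup>2) (2 * m)"
proof (induction m)
  case (Suc m)
  have 1: "(1 - x * (r * y)) * (1 - x * - (r * y)) = 1 - x\<^sup>2 * (q * y\<^sup>2)" for x
    unfolding assms[symmetric] by algebra
  have 2: "(1 - x * (q * y)) * (1 - x * - (q * y)) = 1 - q * x\<^sup>2 * (q * y\<^sup>2)" for x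
    by algebra
  have "qp q (r * y) (Suc m) * qp q (- (r * y)) (Suc m) * (qp q (q * y) (Suc m) * qp q (- (q * y)) (Suc m)) =
    (qp q (r * y) m * qp q (- (r * y)) m * (qp q (q * y) m * qp q (- (q * y)) m)) *
    (((1 - q ^ m * (r * y)) * (1 - q ^ m * - (r * y))) * ((1 - q ^ m * (q * y)) * (1 - q ^ m * - (q * y))))"
    by (simp only: prod.lessThan_Suc mult_ac)
  also have "\<dots> = qp q (q * y\<^sup>2) (2 * Suc m)"
    unfolding Suc 1 2 mult_Suc_right add_2_eq_Suc prod.lessThan_Suc power_Suc power_even_eq
    by (rule mult.assoc[symmetric])
  finally show ?case .
qed simp

text \<open>For \<open>n = m + k\<close>, each factor is
  \<open>1 - q^(i-n) = - q^(i-n) (1 - q^(n-i))\<close>; reversing their order completes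
  \<open>qp q q k\<close> to \<open>qp q q n\<close>.\<close>

lemma qp_inverse_power:
  assumes "q \<noteq> 0"
  shows "qp q (1 / q ^ (m + k)) m * qp q q k = (\<Prod>i<m. - (q ^ i / q ^ (m + k))) * qp q q (m + k)"
proof -
  have "qp q (1 / q ^ (m + k)) m = (\<Prod>i<m. - (q ^ i / q ^ (m + k)) * (1 - q ^ (m - Suc i) * (q ^ k * q)))"
  proof (rule prod.cong)
    fix i assume "i \<in> {..<m}"
    then have "m + k = i + ((m - Suc i) + (k + 1))" by simp
    then have "q ^ i * (q ^ (m - Suc i) * (q ^ k * q)) = q ^ (m + k)"
      by (simp only: power_add power_one_right)
    then show "1 - q ^ i * (1 / q ^ (m + k)) = - (q ^ i / q ^ (m + k)) * (1 - q ^ (m - Suc i) * (q ^ k * q))"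
      using assms by (simp add: field_simps)
  qed simp
  also have "\<dots> = (\<Prod>i<m. - (q ^ i / q ^ (m + k))) * qp q (q ^ k * q) m"
    unfolding prod.distrib prod.nat_diff_reindex[of "\<lambda>i. 1 - q ^ i * (q ^ k * q)"] ..
  finally show ?thesis
    using qp_add[of q q k m] by (simp add: add.commute mult_ac)
qed

text \<open>Expresses that the product is \<open>q^(m(m-1)/2)\<close> without halving an
  exponent.\<close>

lemma prod_power_square: "(\<Prod>i<m. q ^ i)\<^sup>2 * q ^ m = q ^ (m * m)" for q :: complex
  by (induction m) (simp_all add: power_mult_distrib power_add power2_eq_square mult_ac)

text \<open>Collects the signs and monomials left over when a term of the double sum is matched with
  \<open>h\<^sub>m\<close> times a \<open>q\<close>-binomial coefficient.\<close>

lemma qp_sign_factor: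
  fixes a q s :: complex
  assumes "q \<noteq> 0" "s \<noteq> 0"
  shows "(\<Prod>i<m. - (q ^ i / q ^ (m + k))) * q ^ m * (a / s) ^ (m + k) =
    (\<Prod>i<m. - (a / (s * q ^ i))) * (a / (s * q ^ m)) ^ k"
proof -
  define Q where "Q = (\<Prod>i<m. q ^ i)"
  have Q: "Q\<^sup>2 * q ^ m = q ^ (m * m)"
    unfolding Q_def by (rule prod_power_square)
  have Q0: "Q \<noteq> 0"
    by (simp add: Q_def assms)
  have 1: "(\<Prod>i<m. - (q ^ i / q ^ (m + k))) = (- 1) ^ m * Q / q ^ (m * m + m * k)"
    by (simp add: Q_def prod_uminus prod_dividef power_mult power_add power_mult_distrib
        mult.commute[of k m] flip: power_mult)
  have 2: "(\<Prod>i<m. - (a / (s * q ^ i))) = (- 1) ^ m * (a / s) ^ m / Q"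
    by (simp add: Q_def prod_uminus prod_dividef prod.distrib power_divide)
  show ?thesis
    unfolding 1 2 unfolding power_add Q[symmetric] using assms Q0
    by (simp add: power_divide power_mult_distrib field_simps power2_eq_square flip: power_mult power_add)
      (simp add: power_add mult_ac)
qed

lemma qbin_nth_qp:
  assumes "w \<noteq> 0"
  shows "fps_nth (qbin q u w) k = w ^ k * qp q (u / w) k / qp q q k"
proof -
  have "fps_nth (qbin q u w) k = (\<Prod>i<k. w * (1 - q ^ i * (u / w)) / (1 - q ^ i * q))"
    unfolding qbin_def fps_nth_Abs_fps
    using assms by (simp add: right_diff_distrib mult.commute)
  then show ?thesis by (simp add: prod_dividef prod.distrib)
qed

lemma aw_coeff_qp:
  "aw_coeff a b c d q s m =
    qp q s m * qp q (q * s / (a * b)) m * qp q (q * s / (a * c)) m * qp q (q * s / (a * d)) m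
    / (qp q q m * qp q (q\<^sup>2 * s\<^sup>2 / (a * b * c * d)) m) * (\<Prod>i<m. - (a / (s * q ^ i)))"
  unfolding aw_coeff_def prod.distrib[symmetric] prod_dividef[symmetric]
  by (rule prod.cong) (simp_all add: aw_ratio_def Let_def power_add power2_eq_square mult_ac del: minus_diff_eq)

text \<open>The termwise form of the interchange of summations, with outer index
  \<open>n = m + k\<close>.\<close>

lemma aw_series_term:
  assumes q: "norm q < 1" "q \<noteq> 0" and nz: "a \<noteq> 0" "s \<noteq> 0" and r: "r\<^sup>2 = q"
    and gen: "\<And>n::nat. n \<ge> 1 \<Longrightarrow> q ^ n * s\<^sup>2 \<noteq> a\<^sup>2"
  shows "qpoch [q * s\<^sup>2 / a\<^sup>2] q (m + k) / qpoch [q] q (m + k) * (a / s) ^ (m + k) *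
      (qpoch [q powi (- int (m + k)), q ^ (m + k + 1) * s\<^sup>2 / a\<^sup>2, s,
              q * s / (a * b), q * s / (a * c), q * s / (a * d)] q m /
       qpoch [q, q\<^sup>2 * s\<^sup>2 / (a * b * c * d), r * s / a, - (r * s / a), q * s / a, - (q * s / a)] q m * q ^ m)
    = aw_coeff a b c d q s m * fps_nth (qbin q (q * (s * q ^ m) / a) (a / (s * q ^ m))) k"
proof -
  define y where "y = s / a"
  define S where "S = qp q s m * qp q (q * s / (a * b)) m * qp q (q * s / (a * c)) m * qp q (q * s / (a * d)) m"
  define W where "W = qp q (q\<^sup>2 * s\<^sup>2 / (a * b * c * d)) m"
  define A where "A = qp q (q * y\<^sup>2) (m + k)"
  define B where "B = qp q (q ^ (m + k) * (q * y\<^sup>2)) m"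
  define C where "C = qp q (q * y\<^sup>2) (2 * m)"
  define D where "D = qp q (q ^ (2 * m) * (q * y\<^sup>2)) k"
  define R where "R = qp q (1 / q ^ (m + k)) m"
  define g where "g = (\<Prod>i<m. - (q ^ i / q ^ (m + k)))"
  define h where "h = (\<Prod>i<m. - (a / (s * q ^ i)))"
  \<comment> \<open>The factorial of length \<open>n + m\<close> is split after \<open>2 m\<close>
    factors: \<open>C\<close> cancels the last four lower parameters, \<open>D\<close> enters the
    \<open>q\<close>-binomial coefficient.\<close>
  have "A * B = qp q (q * y\<^sup>2) ((m + k) + m)" by (simp only: A_def B_def qp_add)
  also have "(m + k) + m = 2 * m + k" by simp
  also have "qp q (q * y\<^sup>2) (2 * m + k) = C * D" by (simp only: C_def D_def qp_add)
  finally have AB: "A * B = C * D" .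
  have P: "qp q q j \<noteq> 0" for j
    using power_neq_1[OF q(1), of "Suc _"] by (auto simp: mult.commute[of _ q])
  \<comment> \<open>Genericity with respect to \<open>a^2\<close> makes the cancellation of
    \<open>C\<close> legitimate.\<close>
  have "1 - q ^ i * (q * y\<^sup>2) \<noteq> 0" for i
    using gen[of "Suc i"] nz by (simp add: y_def field_simps)
  then have C: "C \<noteq> 0" by (simp add: C_def)
  have R: "R = g * qp q q (m + k) / qp q q k"
    using qp_inverse_power[OF q(2), of m k] P[of k] by (simp add: R_def g_def field_simps)
  have sg: "g * q ^ m * (a / s) ^ (m + k) = h * (a / (s * q ^ m)) ^ k"
    unfolding g_def h_def by (rule qp_sign_factor[OF q(2) nz(2)])
  have bin: "fps_nth (qbin q (q * (s * q ^ m) / a) (a / (s * q ^ m))) k = (a / (s * q ^ m)) ^ k * D / qp q q k"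
  proof -
    have "q * (s * q ^ m) / a / (a / (s * q ^ m)) = q ^ (2 * m) * (q * y\<^sup>2)"
      using nz q by (simp add: y_def power2_eq_square mult_2 power_add)
    then show ?thesis using nz q by (subst qbin_nth_qp) (simp_all add: D_def)
  qed
  have den: "qpoch [q, q\<^sup>2 * s\<^sup>2 / (a * b * c * d), r * s / a, - (r * s / a), q * s / a, - (q * s / a)] q m =
      qp q q m * W * C"
    using qp_double[OF r, of y m] by (simp add: qpoch_def W_def C_def y_def mult.assoc)
  have "q powi (- int (m + k)) = 1 / q ^ (m + k)"
    by (simp add: power_int_minus inverse_eq_divide flip: of_nat_add)
  then have num: "qpoch [q powi (- int (m + k)), q ^ (m + k + 1) * s\<^sup>2 / a\<^sup>2, s,
              q * s / (a * b), q * s / (a * c), q * s / (a * d)] q m = R * B * S"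
    by (simp add: qpoch_def R_def B_def S_def y_def power_divide mult_ac)
  have "A / qp q q (m + k) * (a / s) ^ (m + k) * (R * B * S / (qp q q m * W * C) * q ^ m) =
      (A * B) / C * (g * q ^ m * (a / s) ^ (m + k)) * S / (qp q q k * qp q q m * W)"
  proof -
    have "A / x * z * (g * x / x' * B * S / (y * W * C) * w) = (A * B) / C * (g * w * z) * S / (x' * y * W)"
      if "x \<noteq> 0" for x x' y z w :: complex
      using that by (simp add: mult_ac)
    then show ?thesis unfolding R using P[of "m + k"] by blast
  qed
  also have "\<dots> = D * (h * (a / (s * q ^ m)) ^ k) * S / (qp q q k * qp q q m * W)"
    unfolding AB sg using C by simp
  also have "\<dots> = S / (qp q q m * W) * h * ((a / (s * q ^ m)) ^ k * D / qp q q k)"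
    by (simp add: mult_ac)
  finally show ?thesis
    unfolding num den bin aw_coeff_qp S_def[symmetric] W_def[symmetric] h_def[symmetric]
    by (simp add: qpoch_def A_def y_def power_divide)
qed

lemma aw_series_nth_qhyp:
  assumes q: "norm q < 1" "q \<noteq> 0" and nz: "a \<noteq> 0" "s \<noteq> 0" and r: "r\<^sup>2 = q"
    and gen: "\<And>n::nat. n \<ge> 1 \<Longrightarrow> q ^ n * s\<^sup>2 \<noteq> a\<^sup>2"
  shows "fps_nth (aw_series a b c d q s) n =
    qpoch [q * s\<^sup>2 / a\<^sup>2] q n / qpoch [q] q n * (a / s) ^ n *
      qhyp [q powi (- int n), q ^ (n + 1) * s\<^sup>2 / a\<^sup>2, s, q * s / (a * b), q * s / (a * c), q * s / (a * d)]
        [q\<^sup>2 * s\<^sup>2 / (a * b * c * d), r * s / a, - (r * s / a), q * s / a, - (q * s / a)] q q"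
    (is "_ = ?K * qhyp ?us ?vs q q")
proof -
  have "qpoch ?us q m = 0" if "n < m" for m
  proof -
    \<comment> \<open>The factor with index \<open>n\<close> terminates the series.\<close>
    have "1 - q ^ n * q powi (- int n) = 0"
      using q by (simp add: power_int_minus)
    then have "qp q (q powi (- int n)) m = 0" using that by (intro prod_zero) auto
    then show ?thesis by (simp add: qpoch_def)
  qed
  then have "qhyp ?us ?vs q q = (\<Sum>m\<le>n. qpoch ?us q m / qpoch (q # ?vs) q m * q ^ m)"
    unfolding qhyp_def by (intro suminf_finite) auto
  then have "?K * qhyp ?us ?vs q q = (\<Sum>m\<le>n. ?K * (qpoch ?us q m / qpoch (q # ?vs) q m * q ^ m))"
    by (simp only: sum_distrib_left)
  also have "\<dots> = fps_nth (aw_series a b c d q s) n"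
    unfolding aw_series_def fps_nth_Abs_fps
  proof (rule sum.cong)
    fix m assume "m \<in> {..n}"
    then show "?K * (qpoch ?us q m / qpoch (q # ?vs) q m * q ^ m) =
        aw_coeff a b c d q s m * fps_nth (qbin q (q * (s * q ^ m) / a) (a / (s * q ^ m))) (n - m)"
      using aw_series_term[OF q nz r gen, of m "n - m" b c d] by simp
  qed simp
  finally show ?thesis ..
qed

section \<open>Existence and uniqueness of the eigenfunction\<close>

theorem theorem1p1:
  fixes a b c d q s r :: complex
  assumes "norm q < 1" and "q \<noteq> 0"
    and "a \<noteq> 0" "b \<noteq> 0" "c \<noteq> 0" "d \<noteq> 0"
    and "r ^ 2 = q" \<comment> \<open>\<open>r\<close> is a choice of the square root of \<open>q\<close>\<close>
    and "s \<noteq> 0" \<comment> \<open>this and the next two conditions: \<open>s\<close> is generic\<close>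
    and "\<And>n::nat. n \<ge> 2 \<Longrightarrow> q ^ n * s ^ 2 \<noteq> a * b * c * d"
    and "\<And>n::nat. n \<ge> 1 \<Longrightarrow> q ^ n * s ^ 2 \<noteq> a ^ 2"
  shows "(\<exists>!C. is_aw_series a b c d q s C) \<and>
    (\<forall>C. is_aw_series a b c d q s C \<longrightarrow>
      C = fps_expansion (\<lambda>x. qpoch_inf (a * x) q / qpoch_inf (q * x / a) q) 0 *
          Abs_fps (\<lambda>n.
            qpoch [q * s ^ 2 / a ^ 2] q n / qpoch [q] q n * (a / s) ^ n *
            qhyp [q powi (- int n), q ^ (n + 1) * s ^ 2 / a ^ 2, s,
                  q * s / (a * b), q * s / (a * c), q * s / (a * d)]
                 [q ^ 2 * s ^ 2 / (a * b * c * d), r * s / a, - (r * s / a),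
                  q * s / a, - (q * s / a)] q q))"
    (is "_ \<and> (\<forall>C. _ \<longrightarrow> C = ?G * ?S)")
proof -
  have S: "?S = aw_series a b c d q s"
    by (rule fps_ext) (simp only: fps_nth_Abs_fps aw_series_nth_qhyp[OF assms(1,2,3,8,7,10)])
  have G: "?G = qbin q a (q / a)"
    using fps_expansion_qpoch_inf_quotient[OF assms(1), of a "q / a"] by simp
  have sol: "is_aw_series a b c d q s (?G * ?S)"
    unfolding is_aw_series_iff[OF assms(2)] S G
    using aw_cleared_series[OF assms(1-6,8,9)] by (simp add: aw_series_def aw_coeff_def)
  have unique: "C = ?G * ?S" if "is_aw_series a b c d q s C" for C
  proof -
    \<comment> \<open>Both series have constant term 1, so their difference is a kernel element with
      constant term 0.\<close>
    have "C - ?G * ?S = 0"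
      by (rule aw_cleared_inj[OF assms(1,2,8,9)])
        (use that sol in \<open>simp_all add: is_aw_series_iff[OF assms(2)] aw_cleared_diff\<close>)
    then show ?thesis by simp
  qed
  with sol show ?thesis by blast
qed

end
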